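(* Let $d\in\mathbb{N}$, let $k$ be an integer with $0\le k\le d-1$, and let $\sigma>0$. Suppose $\mathcal{F}$ is a family of compact convex sets in $\mathbb{R}^d$ with condition number $\sigma(F)\ge\sigma$ for all $F\in\mathcal{F}$. Then either $\mathcal{F}$ is pierceable by a finite number of $k$-flats, or $\mathcal{F}$ contains a $k$-independent sequence.
   Context: A $k$-flat is a $k$-dimensional affine subspace of $\mathbb{R}^d$; $\mathcal{F}$ is pierceable by a finite number of $k$-flats if there is a finite set of $k$-flats such that each member of $\mathcal{F}$ meets one of them. For a set $S$, $R_S$ is the radius of the smallest closed ball containing $S$, $r_S$ the radius of the largest closed ball contained in $S$, and $\sigma(S)=r_S/R_S$. A sequence $\{B_n\}_{n\in\mathbb{N}}$ is $k$-dependent if there exist a $k$-flat $K$ and $k+2$ distinct indices $i_1,\dots,i_{k+2}$ with $K\cap B_{i_j}\neq\emptyset$ for all $j$; otherwise it is $k$-independent. *)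

theory Defs
  imports "HOL-Analysis.Analysis"
begin

definition k_flat :: "nat \<Rightarrow> 'a::euclidean_space set \<Rightarrow> bool" where
  "k_flat k K \<longleftrightarrow> affine K \<and> aff_dim K = int k"

definition finitely_pierceable :: "nat \<Rightarrow> 'a::euclidean_space set set \<Rightarrow> bool" where
  "finitely_pierceable k \<F> \<longleftrightarrow>
     (\<exists>\<K>. finite \<K> \<and> (\<forall>K\<in>\<K>. k_flat k K) \<and> (\<forall>F\<in>\<F>. \<exists>K\<in>\<K>. F \<inter> K \<noteq> {}))"

(* The bound 0 \<le> r excludes negative radii, for which cball x r is empty.
   The minimum exists for every bounded set, and the maximum below for every
   nonempty compact set. *)
definition outer_radius :: "'a::euclidean_space set \<Rightarrow> real" where
  "outer_radius S = (LEAST r. 0 \<le> r \<and> (\<exists>x. S \<subseteq> cball x r))"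

definition inner_radius :: "'a::euclidean_space set \<Rightarrow> real" where
  "inner_radius S = (GREATEST r. 0 \<le> r \<and> (\<exists>x. cball x r \<subseteq> S))"

(* For the empty set and for singletons the outer radius is 0, so the quotient,
   mathematically undefined, has the value 0 here: such sets satisfy no positive
   lower bound on the condition number. *)
definition condition_number :: "'a::euclidean_space set \<Rightarrow> real" where
  "condition_number S = inner_radius S / outer_radius S"

definition k_dependent :: "nat \<Rightarrow> (nat \<Rightarrow> 'a::euclidean_space set) \<Rightarrow> bool" where
  "k_dependent k B \<longleftrightarrow>
     (\<exists>K I. k_flat k K \<and> card I = k + 2 \<and> (\<forall>i\<in>I. K \<inter> B i \<noteq> {}))"

abbreviation k_independent :: "nat \<Rightarrow> (nat \<Rightarrow> 'a::euclidean_space set) \<Rightarrow> bool" where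
  "k_independent k B \<equiv> \<not> k_dependent k B"

end

theory Submission imports Defs begin

text \<open>
  Embed the space as the affine hyperplane \<open>UNIV \<times> {1}\<close>, so that \<open>k\<close>-flats become linear
  subspaces of dimension \<open>k + 1\<close>. Suppose the family is not pierceable. The members that look
  large from a given subspace are pierceable by fatness, so by compactness of the sphere of
  directions one finds a flag \<open>{0} = V 0 \<subset> V 1 \<subset> \<dots> \<subset> V k \<subset> T\<close> such that members missing \<open>T\<close>
  are arbitrarily close to the flag: the distance of their points to each member of the flag
  is negligible compared with the distance to the preceding one. In a sequence of members
  converging fast enough to the flag, subspaces of dimension \<open>k + 1\<close> meeting \<open>k + 2\<close> members
  would by compactness yield one that meets the first of them and lies in \<open>T\<close>, which is impossible.
\<close>

section \<open>Limits of subspaces\<close>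

text \<open>An orthonormal basis padded with zero vectors does the job. The padding gives every
  subspace the same number \<open>m\<close> of vectors, so subspaces of varying dimension can be
  compared coordinate by coordinate.\<close>

lemma subspace_orthonormal_expansion:
  fixes W :: "'a::euclidean_space set"
  assumes "subspace W" "dim W \<le> m"
  obtains w :: "nat \<Rightarrow> 'a" where "\<And>i. w i \<in> W" "\<And>i. norm (w i) \<le> 1"
    "\<And>x. x \<in> W \<Longrightarrow> (\<Sum>i<m. (x \<bullet> w i) *\<^sub>R w i) = x"
proof -
  obtain B where B: "B \<subseteq> W" "pairwise orthogonal B" "\<And>x. x \<in> B \<Longrightarrow> norm x = 1"
    "independent B" "card B = dim W" "span B = W"
    using orthonormal_basis_subspace[OF assms(1)] by metis
  have fin: "finite B" using B(4) by (simp add: independent_imp_finite)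
  obtain f where f: "bij_betw f {..<card B} B"
    using ex_bij_betw_nat_finite[OF fin] by (auto simp: atLeast0LessThan)
  define w where "w i = (if i < card B then f i else 0)" for i
  have fB: "f i \<in> B" if "i < card B" for i
    using f that by (auto simp: bij_betw_def)
  show ?thesis
  proof
    show "w i \<in> W" for i using fB B(1) subspace_0[OF assms(1)] by (auto simp: w_def)
    show "norm (w i) \<le> 1" for i using fB B(3) by (auto simp: w_def)
    show "(\<Sum>i<m. (x \<bullet> w i) *\<^sub>R w i) = x" if "x \<in> W" for x
    proof -
      have "(\<Sum>i<m. (x \<bullet> w i) *\<^sub>R w i) = (\<Sum>i<card B. (x \<bullet> w i) *\<^sub>R w i)"
        by (rule sum.mono_neutral_right) (use B(5) assms(2) in \<open>auto simp: w_def\<close>)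
      also have "\<dots> = (\<Sum>i<card B. (x \<bullet> f i) *\<^sub>R f i)"
        by (rule sum.cong) (auto simp: w_def)
      also have "\<dots> = (\<Sum>b\<in>B. (x \<bullet> b) *\<^sub>R b)"
        by (rule sum.reindex_bij_betw[OF f])
      also have "\<dots> = x"
        using orthonormal_basis_expand[OF B(2,3) _ fin] that B(6) by blast
      finally show ?thesis .
    qed
  qed
qed

lemma bounded_finite_subsequences:
  fixes w :: "nat \<Rightarrow> nat \<Rightarrow> 'a::heine_borel"
  assumes "\<And>i. bounded (range (\<lambda>n. w n i))"
  obtains r u where "strict_mono (r :: nat \<Rightarrow> nat)" "\<And>i. i < m \<Longrightarrow> (\<lambda>n. w (r n) i) \<longlonglongrightarrow> u i"
proof -
  have "\<exists>r u. strict_mono (r :: nat \<Rightarrow> nat) \<and> (\<forall>i<m. (\<lambda>n. w (r n) i) \<longlonglongrightarrow> u i)"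
  proof (induction m)
    case 0
    show ?case using strict_mono_id by fastforce
  next
    case (Suc m)
    then obtain r u where r: "strict_mono r" and u: "\<And>i. i < m \<Longrightarrow> (\<lambda>n. w (r n) i) \<longlonglongrightarrow> u i"
      by blast
    have "bounded (range (\<lambda>n. w (r n) m))"
      by (rule bounded_subset[OF assms[of m]]) auto
    then obtain l s where s: "strict_mono s" "((\<lambda>n. w (r n) m) \<circ> s) \<longlonglongrightarrow> l"
      using bounded_imp_convergent_subsequence by blast
    have "(\<lambda>n. w ((r \<circ> s) n) i) \<longlonglongrightarrow> (u(m := l)) i" if "i < Suc m" for i
    proof (cases "i = m")
      case True
      then show ?thesis using s(2) by (simp add: o_def)
    next
      case False
      then show ?thesis using LIMSEQ_subseq_LIMSEQ[OF u s(1), of i] that by (simp add: o_def)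
    qed
    then show ?case using strict_mono_o[OF r s(1)] by blast
  qed
  then show ?thesis using that by blast
qed

text \<open>Says that the Kuratowski upper limit of the sets \<open>W n\<close> lies in
  \<open>L\<close>. The subsequence \<open>s\<close> leaves room for further extractions.\<close>

definition contains_limits :: "(nat \<Rightarrow> 'a::metric_space set) \<Rightarrow> 'a set \<Rightarrow> bool" where
  "contains_limits W L \<longleftrightarrow>
    (\<forall>s x l. strict_mono s \<longrightarrow> (\<forall>n. x n \<in> W (s n)) \<longrightarrow> x \<longlonglongrightarrow> l \<longrightarrow> l \<in> L)"

lemma contains_limitsD:
  "contains_limits W L \<Longrightarrow> strict_mono s \<Longrightarrow> (\<And>n. x n \<in> W (s n)) \<Longrightarrow> x \<longlonglongrightarrow> l \<Longrightarrow> l \<in> L"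
  by (auto simp: contains_limits_def)

text \<open>Along a subsequence the padded orthonormal systems converge vector by vector. The
  expansion identity passes to the limit, so limits of points lie in the span \<open>L\<close> of
  the \<open>m\<close> limit vectors.\<close>

lemma subspace_sequence_limit:
  fixes W :: "nat \<Rightarrow> 'a::euclidean_space set"
  assumes "\<And>n. subspace (W n)" "\<And>n. dim (W n) \<le> m"
  obtains r L where "strict_mono (r :: nat \<Rightarrow> nat)" "subspace L" "dim L \<le> m"
    "contains_limits (\<lambda>n. W (r n)) L"
proof -
  have "\<forall>n. \<exists>w. (\<forall>i. norm (w i) \<le> 1) \<and> (\<forall>x\<in>W n. (\<Sum>i<m. (x \<bullet> w i) *\<^sub>R w i) = x)"
    using subspace_orthonormal_expansion[OF assms] by metis
  then obtain w where w1: "\<And>n i. norm (w n i) \<le> 1"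
    and w2: "\<And>n x. x \<in> W n \<Longrightarrow> (\<Sum>i<m. (x \<bullet> w n i) *\<^sub>R w n i) = x"
    by metis
  have "bounded (range (\<lambda>n. w n i))" for i
    using w1 by (auto simp: bounded_iff)
  then obtain r u where r: "strict_mono r" and u: "\<And>i. i < m \<Longrightarrow> (\<lambda>n. w (r n) i) \<longlonglongrightarrow> u i"
    using bounded_finite_subsequences[of w m] by auto
  show ?thesis
  proof
    show "strict_mono r" by (fact r)
    show "subspace (span (u ` {..<m}))" by simp
    have "dim (span (u ` {..<m})) \<le> card (u ` {..<m})"
      using dim_le_card'[of "u ` {..<m}"] by simp
    also have "\<dots> \<le> m" using card_image_le[of "{..<m}" u] by simp
    finally show "dim (span (u ` {..<m})) \<le> m" .
    have "l \<in> span (u ` {..<m})"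
      if s: "strict_mono s" and x: "\<And>n. x n \<in> W (r (s n))" and l: "x \<longlonglongrightarrow> l" for s x l
    proof -
    have "(\<lambda>n. \<Sum>i<m. (x n \<bullet> w (r (s n)) i) *\<^sub>R w (r (s n)) i) \<longlonglongrightarrow> (\<Sum>i<m. (l \<bullet> u i) *\<^sub>R u i)"
      using LIMSEQ_subseq_LIMSEQ[OF u s] l
      by (auto intro!: tendsto_intros simp: o_def)
    then have "x \<longlonglongrightarrow> (\<Sum>i<m. (l \<bullet> u i) *\<^sub>R u i)"
      using w2[OF x] by simp
    then have "l = (\<Sum>i<m. (l \<bullet> u i) *\<^sub>R u i)"
      using l LIMSEQ_unique by blast
    also have "\<dots> \<in> span (u ` {..<m})"
      by (intro span_sum span_mul span_base) auto
    finally show ?thesis .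
    qed
    then show "contains_limits (\<lambda>n. W (r n)) (span (u ` {..<m}))"
      unfolding contains_limits_def by blast
  qed
qed

lemma limit_meets_compact:
  fixes W :: "nat \<Rightarrow> 'a::metric_space set"
  assumes "compact C" "contains_limits W L" "\<And>n. C \<inter> W n \<noteq> {}"
  shows "C \<inter> L \<noteq> {}"
proof -
  have "\<forall>n. \<exists>x. x \<in> C \<and> x \<in> W n" using assms(3) by blast
  then obtain x where x: "\<And>n. x n \<in> C" "\<And>n. x n \<in> W n" by metis
  obtain l s where "l \<in> C" "strict_mono s" "(x \<circ> s) \<longlonglongrightarrow> l"
    using assms(1) x(1) unfolding compact_def by blast
  moreover from this have "l \<in> L"
    using contains_limitsD[OF assms(2), of s "x \<circ> s" l] x(2) by simp
  ultimately show ?thesis by blast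
qed

section \<open>Sequences converging to a flag\<close>

text \<open>Greedy choice. The invariant is that all subsets of the finite set chosen so far satisfy
  \<open>P\<close>; as there are finitely many, one large \<open>N\<close> extends all of them at
  once.\<close>

lemma hereditary_subsequence:
  fixes P :: "nat set \<Rightarrow> bool"
  assumes "P {}" "\<And>J. finite J \<Longrightarrow> P J \<Longrightarrow> eventually (\<lambda>N. P (insert N J)) sequentially"
  obtains s where "strict_mono (s :: nat \<Rightarrow> nat)" "\<And>I. finite I \<Longrightarrow> P (s ` I)"
proof -
  define Q where "Q S \<longleftrightarrow> finite S \<and> (\<forall>J\<subseteq>S. P J)" for S
  have ex: "\<exists>N. (\<forall>M\<in>S. M < N) \<and> Q (insert N S)" if S: "Q S" for S
  proof -
    have fin: "finite S" using S by (simp add: Q_def)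
    have "eventually (\<lambda>N. \<forall>J\<in>Pow S. P (insert N J)) sequentially"
      using S by (intro eventually_ball_finite) (auto simp: Q_def intro: assms(2) finite_subset)
    moreover have "eventually (\<lambda>N. \<forall>M\<in>S. M < N) sequentially"
      using fin by (intro eventually_ball_finite) (auto simp: eventually_gt_at_top)
    ultimately have "eventually (\<lambda>N. (\<forall>M\<in>S. M < N) \<and> (\<forall>J\<in>Pow S. P (insert N J))) sequentially"
      by eventually_elim auto
    then obtain N where N: "\<forall>M\<in>S. M < N" "\<forall>J\<in>Pow S. P (insert N J)"
      by (auto simp: eventually_sequentially)
    have "P J" if "J \<subseteq> insert N S" for J
    proof (cases "N \<in> J")
      case True
      then have "J = insert N (J - {N})" "J - {N} \<subseteq> S" using that by auto
      then show ?thesis using N(2) by (metis PowI)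
    next
      case False
      then show ?thesis using that S by (auto simp: Q_def)
    qed
    then show ?thesis using N(1) fin by (auto simp: Q_def)
  qed
  define next_idx where "next_idx S = (SOME N. (\<forall>M\<in>S. M < N) \<and> Q (insert N S))" for S
  define T where "T = rec_nat ({} :: nat set) (\<lambda>_ S. insert (next_idx S) S)"
  have T_0: "T 0 = {}" and T_Suc: "T (Suc n) = insert (next_idx (T n)) (T n)" for n
    by (simp_all add: T_def)
  have step: "(\<forall>M\<in>S. M < next_idx S) \<and> Q (insert (next_idx S) S)" if "Q S" for S
    unfolding next_idx_def by (rule someI_ex) (rule ex[OF that])
  have QT: "Q (T n)" for n
    by (induction n) (use assms(1) step in \<open>auto simp: T_0 T_Suc Q_def\<close>)
  define s where "s n = next_idx (T n)" for n
  have T_eq: "T n = s ` {..<n}" for n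
    by (induction n) (auto simp: T_0 T_Suc s_def lessThan_Suc)
  show ?thesis
  proof
    show "strict_mono s"
      using step[OF QT[of "Suc n" for n]] by (auto intro!: strict_mono_Suc_iff[THEN iffD2] simp: s_def T_Suc)
    fix I :: "nat set" assume "finite I"
    then obtain n where "I \<subseteq> {..<n}" using finite_nat_iff_bounded by blast
    then have "s ` I \<subseteq> T n" by (auto simp: T_eq)
    then show "P (s ` I)" using QT by (auto simp: Q_def)
  qed
qed

lemma span_insert_eq_if_dim_le:
  fixes V W :: "'a::euclidean_space set"
  assumes "subspace V" "subspace W" "V \<subseteq> W" "u \<in> W" "u \<notin> V" "dim W \<le> Suc (dim V)"
  shows "W = span (insert u V)"
proof -
  have "span (insert u V) \<subseteq> W"
    using assms by (intro span_minimal) auto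
  moreover have "dim (span (insert u V)) = Suc (dim V)"
    using assms(1,5) by (simp add: dim_insert span_eq_iff[THEN iffD2])
  ultimately show ?thesis
    using assms(2,6) by (metis subspace_dim_equal subspace_span)
qed

text \<open>The components of \<open>y n\<close> off \<open>V\<close> are normalized to unit vectors
  \<open>u n\<close>. They lie in \<open>W n\<close>, stay at distance at least 1 from
  \<open>V\<close>, and are within \<open>e n\<close> of \<open>V'\<close>; a limit point has all
  three properties in the limit.\<close>

lemma limit_gains_direction:
  fixes W :: "nat \<Rightarrow> 'a::euclidean_space set"
  assumes W: "\<And>n. subspace (W n)" "\<And>n. V \<subseteq> W n"
    and V: "subspace V" "subspace V'" "V \<subseteq> V'"
    and y: "\<And>n. y n \<in> W n" "\<And>n. y n \<notin> V"
    and close: "\<And>n. infdist (y n) V' \<le> infdist (y n) V * e n" "e \<longlonglongrightarrow> 0"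
    and r: "strict_mono (r :: nat \<Rightarrow> nat)"
    and L: "contains_limits (\<lambda>n. W (r n)) L"
  obtains u where "u \<in> L" "u \<in> V'" "u \<notin> V"
proof -
  have ne: "V \<noteq> {}" "V' \<noteq> {}" using V subspace_0 by blast+
  have cl: "closed V" "closed V'" using V closed_subspace by auto
  define d where "d n = infdist (y n) V" for n
  have d: "d n > 0" for n
    unfolding d_def using infdist_pos_not_in_closed[OF cl(1) ne(1) y(2)] by simp
  have "\<forall>n. \<exists>v\<in>V. d n = dist (y n) v"
    unfolding d_def using infdist_attains_inf[OF cl(1) ne(1)] by metis
  then obtain v where v: "\<And>n. v n \<in> V" "\<And>n. d n = dist (y n) (v n)" by metis
  have "\<forall>n. \<exists>v\<in>V'. infdist (y n) V' = dist (y n) v"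
    using infdist_attains_inf[OF cl(2) ne(2)] by metis
  then obtain z where z: "\<And>n. z n \<in> V'" "\<And>n. infdist (y n) V' = dist (y n) (z n)" by metis
  define u where "u n = (y n - v n) /\<^sub>R d n" for n
  define q where "q n = (z n - v n) /\<^sub>R d n" for n
  have qV: "q n \<in> V'" for n
    unfolding q_def using V v(1) z(1) by (blast intro: subspace_diff subspace_scale)
  have uW: "u n \<in> W n" for n
    unfolding u_def using W v(1) y(1) by (blast intro: subspace_diff subspace_scale)
  have nu: "norm (u n) = 1" for n
    unfolding u_def using d[of n] v(2)[of n] by (simp add: dist_norm)
  have uq: "norm (u n - q n) \<le> e n" for n
  proof -
    have "u n - q n = (y n - z n) /\<^sub>R d n"
      by (simp add: u_def q_def algebra_simps)
    then have "norm (u n - q n) = infdist (y n) V' / d n"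
      using d[of n] z(2)[of n] by (simp add: dist_norm divide_inverse)
    also have "\<dots> \<le> e n"
      using close(1)[of n] d[of n] by (simp add: d_def divide_le_eq mult.commute)
    finally show ?thesis .
  qed
  \<comment> \<open>Minimality of the nearest point \<open>v n\<close>, rescaled by
    \<open>d n\<close>. This bound keeps the limit out of \<open>V\<close>.\<close>
  have far: "norm (u n - w) \<ge> 1" if "w \<in> V" for n w
  proof -
    have "v n + d n *\<^sub>R w \<in> V" using that V(1) v(1) by (blast intro: subspace_add subspace_scale)
    then have "d n \<le> norm (y n - (v n + d n *\<^sub>R w))"
      unfolding d_def using infdist_le dist_norm by metis
    also have "y n - (v n + d n *\<^sub>R w) = d n *\<^sub>R (u n - w)"
      using d[of n] by (simp add: u_def algebra_simps)
    also have "norm \<dots> = d n * norm (u n - w)" using d[of n] by simp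
    finally show ?thesis using d[of n] by simp
  qed
  have "bounded (range (u \<circ> r))" using nu by (auto simp: bounded_iff)
  then obtain l s where s: "strict_mono s" "((u \<circ> r) \<circ> s) \<longlonglongrightarrow> l"
    using bounded_imp_convergent_subsequence by blast
  then have lim: "(\<lambda>n. u (r (s n))) \<longlonglongrightarrow> l" by (simp add: o_def)
  have "l \<in> L" using contains_limitsD[OF L s(1) _ lim] uW by blast
  moreover have "l \<in> V'"
  proof -
    have "(\<lambda>n. norm (u n - q n)) \<longlonglongrightarrow> 0"
      using uq close(2) by (intro tendsto_sandwich[OF _ _ tendsto_const close(2)]) auto
    then have "(\<lambda>n. u n - q n) \<longlonglongrightarrow> 0" by (simp add: tendsto_norm_zero_iff)
    then have "(\<lambda>n. u (r (s n)) - q (r (s n))) \<longlonglongrightarrow> 0"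
      using LIMSEQ_subseq_LIMSEQ[OF _ strict_mono_o[OF r s(1)]] by (fastforce simp: o_def)
    from tendsto_diff[OF lim this] have "(\<lambda>n. q (r (s n))) \<longlonglongrightarrow> l" by simp
    then show ?thesis using closed_sequentially[OF cl(2), of "\<lambda>n. q (r (s n))"] qV by blast
  qed
  moreover have "l \<notin> V"
  proof
    assume "l \<in> V"
    have "(\<lambda>n. norm (u (r (s n)) - l)) \<longlonglongrightarrow> norm (l - l)"
      using lim by (intro tendsto_intros)
    then have "1 \<le> norm (l - l)"
      by (rule LIMSEQ_le_const) (use far[OF \<open>l \<in> V\<close>] in auto)
    then show False by simp
  qed
  ultimately show ?thesis using that by blast
qed

text \<open>
  The invariant behind the selection: a set of \<open>j\<close> chosen members has no common transversal
  \<open>W\<close> with \<open>V (k + 2 - j) \<subseteq> W\<close>. For \<open>j = 1\<close> the inclusion is reversed, because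
  \<open>V (k + 1)\<close> may have any dimension. A transversal of \<open>J\<close> and of members \<open>A N\<close> with
  \<open>N\<close> tending to infinity gains one more member of the flag in the limit.
\<close>
lemma independent_subsequence_near_flag:
  fixes A V :: "nat \<Rightarrow> 'a::euclidean_space set"
  assumes A: "\<And>N. compact (A N)" "\<And>N. A N \<inter> V (Suc k) = {}"
    and V: "\<And>i. i \<le> Suc k \<Longrightarrow> subspace (V i)" "\<And>i. i \<le> k \<Longrightarrow> V i \<subseteq> V (Suc i)"
      "\<And>i. i \<le> k \<Longrightarrow> dim (V i) = i"
    and close: "\<And>N i y. i \<le> k \<Longrightarrow> y \<in> A N \<Longrightarrow> infdist y (V (Suc i)) \<le> infdist y (V i) * inverse (real (Suc N))"
  obtains s where "strict_mono (s :: nat \<Rightarrow> nat)"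
    "\<And>I W. card I = k + 2 \<Longrightarrow> subspace W \<Longrightarrow> dim W \<le> Suc k \<Longrightarrow> \<exists>i\<in>I. A (s i) \<inter> W = {}"
proof -
  define Q where "Q i W \<longleftrightarrow> subspace W \<and> dim W \<le> Suc k \<and> (if i \<le> k then V i \<subseteq> W else W \<subseteq> V (Suc k))" for i W
  \<comment> \<open>\<open>P\<close> holds by decree for the empty set, where the selection starts,
    and beyond \<open>k + 2\<close> elements, where the subtraction \<open>k + 2 - card J\<close>
    would be truncated at 0.\<close>
  define P where "P J \<longleftrightarrow> J = {} \<or> card J > k + 2 \<or>
    \<not> (\<exists>W. Q (k + 2 - card J) W \<and> (\<forall>j\<in>J. A j \<inter> W \<noteq> {}))" for J
  have P_empty: "P {}" by (simp add: P_def)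
  have chain: "V i \<subseteq> V j" if "i \<le> j" "j \<le> Suc k" for i j
    using that by (induction j rule: dec_induct) (use V(2) in \<open>auto simp: subset_iff\<close>)
  have ext: "eventually (\<lambda>N. P (insert N J)) sequentially" if J: "finite J" "P J" for J
  proof (cases "J = {}")
    case True
    \<comment> \<open>Here the index is \<open>k + 1\<close>, so a transversal would lie in
      \<open>V (Suc k)\<close>, which \<open>A N\<close> misses.\<close>
    have "P {N}" for N
      using A(2)[of N] by (force simp: P_def Q_def)
    then show ?thesis using True by simp
  next
    case False
    show ?thesis
    proof (rule ccontr)
      \<comment> \<open>Failure for infinitely many \<open>N\<close> gives transversals
        \<open>W n\<close> of \<open>J\<close> and \<open>A (t n)\<close>. A limit \<open>L\<close>
        still meets the compact members indexed by \<open>J\<close>, and the closeness of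
        \<open>A (t n)\<close> to the flag supplies a new direction in \<open>L\<close>, which
        contradicts \<open>P J\<close>.\<close>
      assume "\<not> eventually (\<lambda>N. P (insert N J)) sequentially"
      then obtain t where t: "strict_mono (t :: nat \<Rightarrow> nat)" and tP: "\<And>n. \<not> P (insert (t n) J)"
        using not_eventually_sequentiallyD by blast
      have nin: "t n \<notin> J" for n
      proof
        assume "t n \<in> J"
        then have "insert (t n) J = J" by auto
        then show False using tP[of n] J(2) by simp
      qed
      have cJ: "card (insert (t n) J) = Suc (card J)" for n
        using nin J(1) by simp
      have le: "Suc (card J) \<le> k + 2" using tP[of 0] by (auto simp: P_def cJ)
      define i where "i = k + 2 - Suc (card J)"
      have cpos: "card J > 0" using False J(1) by (simp add: card_gt_0_iff)
      then have ik: "i \<le> k" and i': "k + 2 - card J = Suc i" using le by (auto simp: i_def)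
      have "\<forall>n. \<exists>W. Q i W \<and> (\<forall>j\<in>insert (t n) J. A j \<inter> W \<noteq> {})"
        using tP by (auto simp: P_def cJ i_def)
      then obtain W where WQ: "\<And>n. Q i (W n)" and WA: "\<And>n j. j \<in> insert (t n) J \<Longrightarrow> A j \<inter> W n \<noteq> {}"
        by metis
      have W: "\<And>n. subspace (W n)" "\<And>n. dim (W n) \<le> Suc k" "\<And>n. V i \<subseteq> W n"
        using WQ ik by (auto simp: Q_def)
      obtain r :: "nat \<Rightarrow> nat" and L where r: "strict_mono r" and L: "subspace L" "dim L \<le> Suc k"
        and lim: "contains_limits (\<lambda>n. W (r n)) L"
        using subspace_sequence_limit[of W "Suc k", OF W(1,2)] by blast
      have meets: "\<forall>j\<in>J. A j \<inter> L \<noteq> {}"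
        using limit_meets_compact[OF A(1) lim] WA by blast
      have VL: "V i \<subseteq> L"
        using contains_limitsD[OF lim strict_mono_id, of "\<lambda>_. x" x for x] W(3) by auto
      have "\<forall>n. \<exists>y. y \<in> A (t n) \<and> y \<in> W n" using WA by blast
      then obtain y where y: "\<And>n. y n \<in> A (t n)" "\<And>n. y n \<in> W n" by metis
      have yV: "y n \<notin> V i" for n
        using y(1)[of n] A(2)[of "t n"] chain[of i "Suc k"] ik by auto
      have e: "(\<lambda>n. inverse (real (Suc (t n)))) \<longlonglongrightarrow> 0"
        using LIMSEQ_subseq_LIMSEQ[OF LIMSEQ_inverse_real_of_nat t] by (simp add: o_def)
      obtain u where u: "u \<in> L" "u \<in> V (Suc i)" "u \<notin> V i"
      proof (rule limit_gains_direction[of W "V i" "V (Suc i)" y, OF W(1,3) _ _ _ y(2) yV _ e r lim])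
        show "subspace (V i)" "subspace (V (Suc i))" "V i \<subseteq> V (Suc i)"
          using V ik by auto
        show "infdist (y n) (V (Suc i)) \<le> infdist (y n) (V i) * inverse (real (Suc (t n)))" for n
          using close ik y(1) by blast
      qed auto
      \<comment> \<open>The new direction \<open>u\<close> spans \<open>V (Suc i)\<close> together
        with \<open>V i\<close> as long as \<open>i < k\<close>. For \<open>i = k\<close> the roles
        change: \<open>L\<close> has dimension at most \<open>k + 1\<close> and is itself spanned by
        \<open>u\<close> and \<open>V k\<close>, hence lies in \<open>V (Suc k)\<close>.\<close>
      have "Q (Suc i) L"
      proof (cases "i = k")
        case True
        have "L = span (insert u (V k))"
          using V[of k] L VL u True by (intro span_insert_eq_if_dim_le) auto
        also have "\<dots> \<subseteq> V (Suc k)"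
          using u V(1)[of "Suc k"] V(2)[of k] True by (intro span_minimal) auto
        finally show ?thesis using L True by (simp add: Q_def)
      next
        case False
        have "V (Suc i) = span (insert u (V i))"
          using V ik u False by (intro span_insert_eq_if_dim_le) auto
        also have "\<dots> \<subseteq> L" using u VL L by (intro span_minimal) auto
        finally show ?thesis using L False ik by (simp add: Q_def)
      qed
      then show False using J(2) False meets le i' by (auto simp: P_def)
    qed
  qed
  obtain s :: "nat \<Rightarrow> nat" where s: "strict_mono s" "\<And>I. finite I \<Longrightarrow> P (s ` I)"
    using hereditary_subsequence[of P, OF _ ext] P_empty by blast
  show ?thesis
  proof
    show "strict_mono s" by (fact s(1))
    fix I :: "nat set" and W :: "'a set" assume I: "card I = k + 2" and W: "subspace W" "dim W \<le> Suc k"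
    have "finite I" "I \<noteq> {}" using I by (auto intro: card_ge_0_finite)
    moreover have "card (s ` I) = k + 2"
      using I s(1) by (simp add: card_image strict_mono_imp_inj_on inj_on_subset)
    \<comment> \<open>For \<open>k + 2\<close> members the index is 0, and \<open>V 0 = {0}\<close>
      imposes no condition on \<open>W\<close>.\<close>
    moreover have "V 0 \<subseteq> W"
      using V(1,3)[of 0] subspace_0[OF W(1)] by (auto simp: dim_eq_0)
    ultimately show "\<exists>i\<in>I. A (s i) \<inter> W = {}"
      using s(2)[of I] W by (auto simp: P_def Q_def)
  qed
qed

section \<open>Radii\<close>

text \<open>\<open>LEAST\<close> on the reals is meaningful only if the minimum exists. The
  admissible radii form a closed set, because centres of covering balls of bounded radius
  subconverge, so the infimum is attained.\<close>

lemma outer_radius_attained: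
  fixes S :: "'a::euclidean_space set"
  assumes "bounded S"
  shows "0 \<le> outer_radius S \<and> (\<exists>x. S \<subseteq> cball x (outer_radius S))"
proof -
  define R where "R = {r. 0 \<le> r \<and> (\<exists>x. S \<subseteq> cball x r)}"
  have "closed R"
    unfolding closed_sequential_limits
  proof (intro allI impI, elim conjE)
    fix f r assume f: "\<forall>n. f n \<in> R" and lim: "f \<longlonglongrightarrow> r"
    have "0 \<le> r" by (rule LIMSEQ_le_const[OF lim]) (use f in \<open>auto simp: R_def\<close>)
    have "\<forall>n. \<exists>x. S \<subseteq> cball x (f n)" using f by (auto simp: R_def)
    then obtain c where c: "\<And>n. S \<subseteq> cball (c n) (f n)" by metis
    show "r \<in> R"
    \<comment> \<open>Balls covering the empty set may have arbitrary centres, so \<open>c\<close>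
      is bounded only in the other case.\<close>
    proof (cases "S = {}")
      case True
      then show ?thesis using \<open>0 \<le> r\<close> by (simp add: R_def)
    next
      case False
      then obtain p where p: "p \<in> S" by blast
      obtain M where M: "\<And>n. norm (f n) \<le> M"
        using convergent_imp_Bseq[OF convergentI[OF lim]] by (auto simp: Bseq_def)
      have "dist p (c n) \<le> M" for n
        using c[of n] p M[of n] by (force simp: dist_commute)
      then have "bounded (range c)" unfolding bounded_def by blast
      then obtain l s where s: "strict_mono s" "(c \<circ> s) \<longlonglongrightarrow> l"
        using bounded_imp_convergent_subsequence by blast
      have "dist l y \<le> r" if "y \<in> S" for y
      proof (rule LIMSEQ_le)
        show "(\<lambda>n. dist ((c \<circ> s) n) y) \<longlonglongrightarrow> dist l y" by (intro tendsto_intros s(2))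
        show "(f \<circ> s) \<longlonglongrightarrow> r" by (rule LIMSEQ_subseq_LIMSEQ[OF lim s(1)])
        show "\<exists>N. \<forall>n\<ge>N. dist ((c \<circ> s) n) y \<le> (f \<circ> s) n" using c that by force
      qed
      then have "S \<subseteq> cball l r" by auto
      then show ?thesis using \<open>0 \<le> r\<close> unfolding R_def by blast
    qed
  qed
  moreover have "R \<noteq> {}"
  proof -
    obtain x e where "S \<subseteq> cball x e" using assms by (auto simp: bounded_subset_cball)
    then have "S \<subseteq> cball x (max e 0)" by (force simp: subset_iff)
    then show ?thesis unfolding R_def by fastforce
  qed
  moreover have "bdd_below R" by (auto simp: R_def)
  ultimately have Inf: "Inf R \<in> R" by (intro closed_contains_Inf)
  have "outer_radius S = Inf R"
    unfolding outer_radius_def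
    by (rule Least_equality) (use Inf in \<open>auto simp: R_def intro!: cInf_lower\<close>)
  then show ?thesis using Inf by (simp add: R_def)
qed

text \<open>As for the outer radius: centres of inscribed balls lie in the compact set
  \<open>S\<close> and subconverge, so the admissible radii form a closed bounded set and the
  supremum is a maximum.\<close>

lemma inner_radius_attained:
  fixes S :: "'a::euclidean_space set"
  assumes "compact S" "S \<noteq> {}"
  shows "\<exists>x. cball x (inner_radius S) \<subseteq> S"
proof -
  define R where "R = {r. 0 \<le> r \<and> (\<exists>x. cball x r \<subseteq> S)}"
  have cl: "closed S" using assms(1) by (rule compact_imp_closed)
  have "closed R"
    unfolding closed_sequential_limits
  proof (intro allI impI, elim conjE)
    fix f r assume f: "\<forall>n. f n \<in> R" and lim: "f \<longlonglongrightarrow> r"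
    have r: "0 \<le> r" by (rule LIMSEQ_le_const[OF lim]) (use f in \<open>auto simp: R_def\<close>)
    have "\<forall>n. \<exists>x. cball x (f n) \<subseteq> S" using f by (auto simp: R_def)
    then obtain c where c: "\<And>n. cball (c n) (f n) \<subseteq> S" by metis
    have f0: "0 \<le> f n" for n using f by (auto simp: R_def)
    have "c n \<in> S" for n using c[of n] f0[of n] by force
    then obtain l s where l: "l \<in> S" and s: "strict_mono s" "(c \<circ> s) \<longlonglongrightarrow> l"
      using assms(1) unfolding compact_def by blast
    have "y \<in> S" if y: "y \<in> cball l r" for y
    proof (cases "r = 0")
      case True
      then show ?thesis using that l by simp
    next
      case False
      \<comment> \<open>The point of the approximating ball in the same relative position as
        \<open>y\<close> in the limit ball; it lies in \<open>S\<close> and tends to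
        \<open>y\<close>.\<close>
      define g where "g n = c (s n) + (f (s n) / r) *\<^sub>R (y - l)" for n
      have "norm (y - l) \<le> r" using y by (simp add: dist_norm norm_minus_commute)
      then have "f (s n) / r * norm (y - l) \<le> f (s n)" for n
        using mult_left_mono[OF _ f0[of "s n"], of "norm (y - l) / r" 1] r False by simp
      then have "g n \<in> cball (c (s n)) (f (s n))" for n
        using f0[of "s n"] r by (simp add: g_def dist_norm)
      then have "g n \<in> S" for n using c by blast
      moreover have "(\<lambda>n. c (s n)) \<longlonglongrightarrow> l" "(\<lambda>n. f (s n)) \<longlonglongrightarrow> r"
        using s(2) LIMSEQ_subseq_LIMSEQ[OF lim s(1)] by (simp_all add: o_def)
      then have "g \<longlonglongrightarrow> l + (r / r) *\<^sub>R (y - l)"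
        unfolding g_def using False by (intro tendsto_intros)
      ultimately show ?thesis using closed_sequentially[OF cl, of g] False by simp
    qed
    then show "r \<in> R" using r unfolding R_def by blast
  qed
  moreover have "R \<noteq> {}"
  proof -
    obtain x where "x \<in> S" using assms(2) by blast
    then have "cball x 0 \<subseteq> S" by simp
    then show ?thesis unfolding R_def by blast
  qed
  moreover have bdd: "bdd_above R"
  proof -
    obtain x e where "S \<subseteq> cball x e"
      using compact_imp_bounded[OF assms(1)] by (auto simp: bounded_subset_cball)
    then have "r \<le> e" if r: "r \<in> R" for r
    proof -
      obtain y where "cball y r \<subseteq> cball x e" using r \<open>S \<subseteq> cball x e\<close> by (auto simp: R_def)
      then have "dist y x + r \<le> e" using r by (auto simp: R_def cball_subset_cball_iff)
      then show ?thesis using zero_le_dist[of y x] by linarith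
    qed
    then show ?thesis by (auto simp: bdd_above_def)
  qed
  ultimately have Sup: "Sup R \<in> R" by (intro closed_contains_Sup)
  have "inner_radius S = Sup R"
    unfolding inner_radius_def
    by (rule Greatest_equality) (use Sup bdd in \<open>auto simp: R_def intro!: cSup_upper\<close>)
  then show ?thesis using Sup by (simp add: R_def)
qed

lemma condition_number_bound:
  fixes S :: "'a::euclidean_space set"
  assumes "compact S" "0 < \<sigma>" "\<sigma> \<le> condition_number S"
  shows "0 < outer_radius S" "\<And>x y. x \<in> S \<Longrightarrow> y \<in> S \<Longrightarrow> dist x y \<le> 2 * outer_radius S"
    "\<exists>z. cball z (\<sigma> * outer_radius S) \<subseteq> S"
proof -
  note outer = outer_radius_attained[OF compact_imp_bounded[OF assms(1)]]
  show pos: "0 < outer_radius S"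
    \<comment> \<open>Division by zero gives 0, so a vanishing outer radius contradicts
      \<open>0 < \<sigma>\<close>.\<close>
    using outer assms(2,3) unfolding condition_number_def by (cases "outer_radius S = 0") auto
  show "dist x y \<le> 2 * outer_radius S" if "x \<in> S" "y \<in> S" for x y
  proof -
    obtain c where "S \<subseteq> cball c (outer_radius S)" using outer by blast
    then have "dist c x \<le> outer_radius S" "dist c y \<le> outer_radius S" using that by auto
    then show ?thesis using dist_triangle3[of x y c] by linarith
  qed
  have "S \<noteq> {}"
  proof
    assume "S = {}"
    then have "outer_radius S = 0"
      unfolding outer_radius_def by (intro Least_equality) auto
    then show False using pos by simp
  qed
  then obtain z where z: "cball z (inner_radius S) \<subseteq> S"
    using inner_radius_attained[OF assms(1)] by blast
  have "\<sigma> * outer_radius S \<le> inner_radius S"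
    using assms(3) pos by (simp add: condition_number_def pos_le_divide_eq)
  then have "cball z (\<sigma> * outer_radius S) \<subseteq> cball z (inner_radius S)"
    by (rule subset_cball)
  then show "\<exists>z. cball z (\<sigma> * outer_radius S) \<subseteq> S" using z by blast
qed

section \<open>Piercing by linear subspaces of the homogenization\<close>

text \<open>
  The space is embedded as \<open>UNIV \<times> {1}\<close>, so that \<open>k\<close>-flats become linear subspaces of
  dimension \<open>k + 1\<close>, and directions at infinity become vectors of \<open>UNIV \<times> {0}\<close>.
\<close>

lemma affine_extend_aff_dim:
  fixes S :: "'a::euclidean_space set"
  assumes "aff_dim S \<le> int k" "k \<le> DIM('a)"
  shows "\<exists>K. k_flat k K \<and> S \<subseteq> K"
  using assms(1)
proof (induction "nat (int k - aff_dim S)" arbitrary: S)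
  case 0
  then have "k_flat k (affine hull S)" by (simp add: k_flat_def)
  then show ?case using hull_subset[of S affine] by blast
next
  case (Suc n)
  then have "aff_dim S < int k" by simp
  then have "affine hull S \<noteq> UNIV" using assms(2) by (metis aff_dim_affine_hull aff_dim_UNIV not_le of_nat_le_iff)
  then obtain a where a: "a \<notin> affine hull S" by blast
  then have "aff_dim (insert a S) = aff_dim S + 1" by (simp add: aff_dim_insert)
  then have "\<exists>K. k_flat k K \<and> insert a S \<subseteq> K"
    using Suc.hyps(2) \<open>aff_dim S < int k\<close> by (intro Suc.hyps(1)) auto
  then show ?case by blast
qed

lemma linear_pair_zero: "linear (\<lambda>x::'a::euclidean_space. (x, 0::real))"
  by (auto intro!: linearI simp: zero_prod_def)

lemma subspace_horizontal: "subspace {w :: 'a::euclidean_space \<times> real. snd w = 0}"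
  by (auto simp: subspace_def)

text \<open>The differences of points of the slice lie in \<open>W\<close> at height 0, and
  \<open>(a, 1)\<close> is independent of them. Hence slicing at height 1 costs a dimension.\<close>

lemma aff_dim_slice_le:
  fixes W :: "('a::euclidean_space \<times> real) set"
  assumes "subspace W" "dim W \<le> Suc k"
  shows "aff_dim {x. (x, 1) \<in> W} \<le> int k"
proof (cases "{x. (x, 1) \<in> W} = {}")
  case True
  then show ?thesis by (simp only: aff_dim_empty)
next
  case False
  then obtain a where a: "(a, 1) \<in> W" by blast
  define S where "S = {x. (x, 1::real) \<in> W}"
  define D where "D = (\<lambda>x. x - a) ` S"
  let ?D = "(\<lambda>x. (x, 0::real)) ` D"
  have sub: "insert (a, 1) ?D \<subseteq> W"
  proof -
    have "(x - a, 0) \<in> W" if "x \<in> S" for x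
      using subspace_diff[OF assms(1), of "(x, 1)" "(a, 1)"] that a by (simp add: S_def)
    then show ?thesis using a by (auto simp: D_def)
  qed
  have "span ?D \<subseteq> {w. snd w = 0}"
    by (rule span_minimal) (auto simp: subspace_horizontal)
  then have "(a, 1) \<notin> span ?D" by auto
  then have "dim (insert (a, 1) ?D) = Suc (dim ?D)" by (simp add: dim_insert)
  moreover have "dim ?D = dim D"
    by (rule dim_image_eq[OF linear_pair_zero]) (auto intro: inj_onI)
  moreover have "dim (insert (a, 1) ?D) \<le> Suc k"
    using dim_subset[OF sub] assms(2) by simp
  moreover have "aff_dim S = int (dim D)"
    unfolding D_def by (rule aff_dim_eq_dim_subtract) (use a in \<open>simp add: S_def hull_inc\<close>)
  ultimately show ?thesis by (simp add: S_def)
qed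

lemma k_flat_homogenize:
  fixes K :: "'a::euclidean_space set"
  assumes "k_flat k K"
  obtains W :: "('a \<times> real) set" where "subspace W" "dim W \<le> Suc k" "\<And>x. x \<in> K \<Longrightarrow> (x, 1) \<in> W"
proof -
  have "K \<noteq> {}" using assms by (auto simp: k_flat_def)
  then obtain a where a: "a \<in> K" by blast
  define D where "D = (\<lambda>x. x - a) ` K"
  let ?B = "insert (a, 1) ((\<lambda>x. (x, 0::real)) ` D)"
  have "int (dim D) = int k"
    unfolding D_def using assms a aff_dim_eq_dim_subtract[of a K] by (simp add: k_flat_def hull_inc)
  moreover have "dim ((\<lambda>x. (x, 0::real)) ` D) \<le> dim D"
    by (rule dim_image_le[OF linear_pair_zero])
  ultimately have "dim ?B \<le> Suc k" by (simp add: dim_insert)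
  moreover have "(x, 1) \<in> span ?B" if "x \<in> K" for x
  proof -
    have "(x - a, 0) \<in> span ?B" "(a, 1) \<in> span ?B"
      using that by (auto simp: D_def intro!: span_base)
    from span_add[OF this] show ?thesis by simp
  qed
  ultimately show ?thesis using that[of "span ?B"] by simp
qed

definition pierceable :: "nat \<Rightarrow> 'a::euclidean_space set set \<Rightarrow> bool" where
  "pierceable m \<G> \<longleftrightarrow> (\<exists>\<W> :: ('a \<times> real) set set. finite \<W> \<and> (\<forall>W\<in>\<W>. subspace W \<and> dim W \<le> m) \<and>
     (\<forall>G\<in>\<G>. \<exists>W\<in>\<W>. \<exists>x\<in>G. (x, 1) \<in> W))"

lemma pierceable_imp_finitely_pierceable:
  fixes \<F> :: "'a::euclidean_space set set"
  assumes "pierceable (Suc k) \<F>" "k \<le> DIM('a)"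
  shows "finitely_pierceable k \<F>"
proof -
  obtain \<W> :: "('a \<times> real) set set" where \<W>: "finite \<W>" "\<And>W. W \<in> \<W> \<Longrightarrow> subspace W \<and> dim W \<le> Suc k"
    "\<And>G. G \<in> \<F> \<Longrightarrow> \<exists>W\<in>\<W>. \<exists>x\<in>G. (x, 1) \<in> W"
    using assms(1) unfolding pierceable_def by metis
  have "\<forall>W\<in>\<W>. \<exists>K. k_flat k K \<and> {x. (x, 1) \<in> W} \<subseteq> K"
    using \<W>(2) assms(2) by (blast intro: affine_extend_aff_dim aff_dim_slice_le)
  then obtain K where K: "\<And>W. W \<in> \<W> \<Longrightarrow> k_flat k (K W) \<and> {x. (x, 1) \<in> W} \<subseteq> K W" by metis
  show ?thesis
    unfolding finitely_pierceable_def
  proof (intro exI conjI ballI)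
    show "finite (K ` \<W>)" using \<W>(1) by simp
    show "k_flat k L" if "L \<in> K ` \<W>" for L using K that by blast
    show "\<exists>L\<in>K ` \<W>. F \<inter> L \<noteq> {}" if "F \<in> \<F>" for F using \<W>(3)[OF that] K by blast
  qed
qed

section \<open>Unions and compactness for piercing\<close>

lemma pierceable_mono: "pierceable m \<H> \<Longrightarrow> \<G> \<subseteq> \<H> \<Longrightarrow> pierceable m \<G>"
  unfolding pierceable_def by (erule ex_forward) auto

lemma pierceable_UN:
  fixes \<G> :: "'b \<Rightarrow> 'a::euclidean_space set set"
  assumes "finite I" "\<And>i. i \<in> I \<Longrightarrow> pierceable m (\<G> i)"
  shows "pierceable m (\<Union>i\<in>I. \<G> i)"
proof -
  have "\<forall>i\<in>I. \<exists>\<W> :: ('a \<times> real) set set. finite \<W> \<and> (\<forall>W\<in>\<W>. subspace W \<and> dim W \<le> m) \<and>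
     (\<forall>G\<in>\<G> i. \<exists>W\<in>\<W>. \<exists>x\<in>G. (x, 1) \<in> W)"
    using assms(2) by (simp add: pierceable_def)
  from bchoice[OF this] obtain \<W> :: "'b \<Rightarrow> ('a \<times> real) set set"
    where W: "\<forall>i\<in>I. finite (\<W> i) \<and> (\<forall>W\<in>\<W> i. subspace W \<and> dim W \<le> m) \<and>
      (\<forall>G\<in>\<G> i. \<exists>W\<in>\<W> i. \<exists>x\<in>G. (x, 1) \<in> W)" ..
  show ?thesis
    unfolding pierceable_def
    by (rule exI[of _ "\<Union>i\<in>I. \<W> i"]) (use assms(1) W in \<open>blast intro: finite_UN_I\<close>)
qed

lemma pierceable_Un:
  assumes "pierceable m \<G>" "pierceable m \<H>"
  shows "pierceable m (\<G> \<union> \<H>)"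
proof -
  have "pierceable m (\<Union>b\<in>{True, False}. if b then \<G> else \<H>)"
    by (rule pierceable_UN) (use assms in auto)
  moreover have "(\<Union>b\<in>{True, False}. if b then \<G> else \<H>) = \<G> \<union> \<H>" by auto
  ultimately show ?thesis by simp
qed

lemma pierceable_subspace:
  fixes W :: "('a::euclidean_space \<times> real) set"
  shows "subspace W \<Longrightarrow> dim W \<le> m \<Longrightarrow> pierceable m {F. \<exists>x\<in>F. (x, 1) \<in> W}"
  unfolding pierceable_def by (rule exI[of _ "{W}"]) auto

text \<open>A finite \<open>e\<close>-net of \<open>K\<close> suffices: the target \<open>h\<close>
  of each member is within \<open>e\<close> of some net point \<open>q\<close>, and adjoining
  \<open>q\<close> to \<open>V\<close> raises the dimension by at most one.\<close>

lemma pierceable_net: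
  fixes V K :: "('a::euclidean_space \<times> real) set"
  assumes V: "dim V < m" and K: "compact K" and e: "0 < e"
    and h: "\<And>F. F \<in> \<G> \<Longrightarrow> \<exists>h\<in>K. \<forall>q\<in>K. norm (q - h) < e \<longrightarrow> (\<exists>x\<in>F. (x, 1) \<in> span (insert q V))"
  shows "pierceable m \<G>"
proof -
  have "K \<subseteq> (\<Union>q\<in>K. ball q e)" using e by force
  then obtain Q where Q: "Q \<subseteq> K" "finite Q" "K \<subseteq> (\<Union>q\<in>Q. ball q e)"
    using compactE_image[OF K, of K "\<lambda>q. ball q e"] by auto
  show ?thesis
    unfolding pierceable_def
  proof (intro exI conjI ballI)
    show "finite ((\<lambda>q. span (insert q V)) ` Q)" using Q(2) by simp
    show "subspace W" if "W \<in> (\<lambda>q. span (insert q V)) ` Q" for W using that by auto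
    show "dim W \<le> m" if "W \<in> (\<lambda>q. span (insert q V)) ` Q" for W
      using that V by (auto simp: dim_insert)
    fix F assume "F \<in> \<G>"
    then obtain h0 where h0: "h0 \<in> K" "\<And>q. q \<in> K \<Longrightarrow> norm (q - h0) < e \<Longrightarrow> \<exists>x\<in>F. (x, 1) \<in> span (insert q V)"
      using h by blast
    obtain q where q: "q \<in> Q" "dist q h0 < e" using Q(3) h0(1) by auto
    then have "\<exists>x\<in>F. (x, 1) \<in> span (insert q V)"
      using h0(2)[of q] Q(1) by (auto simp: dist_norm)
    then show "\<exists>W\<in>(\<lambda>q. span (insert q V)) ` Q. \<exists>x\<in>F. (x, 1) \<in> W" using q(1) by blast
  qed
qed

text \<open>Otherwise each \<open>u\<close> in \<open>S\<close> has a neighbourhood and a scale at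
  which the members with direction there are pierceable. Finitely many neighbourhoods cover
  \<open>S\<close>, and at the smallest of their scales the whole family would be
  pierceable.\<close>

lemma nonpierceable_direction:
  fixes \<H> :: "real \<Rightarrow> 'a::euclidean_space set set" and S :: "'b::metric_space set"
  assumes S: "compact S" and dir: "\<And>e F. 0 < e \<Longrightarrow> F \<in> \<H> e \<Longrightarrow> dir F \<in> S"
    and mono: "\<And>d e. d \<le> e \<Longrightarrow> \<H> d \<subseteq> \<H> e"
    and np: "\<And>e. 0 < e \<Longrightarrow> \<not> pierceable m (\<H> e)"
  obtains u where "u \<in> S" "\<And>e. 0 < e \<Longrightarrow> \<not> pierceable m {F \<in> \<H> e. dist (dir F) u < e}"
proof (rule ccontr)
  assume "\<not> thesis"
  then have "\<forall>u\<in>S. \<exists>e>0. pierceable m {F \<in> \<H> e. dist (dir F) u < e}" using that by blast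
  from bchoice[OF this] obtain e where
    "\<forall>u\<in>S. 0 < e u \<and> pierceable m {F \<in> \<H> (e u). dist (dir F) u < e u}" ..
  then have e: "\<And>u. u \<in> S \<Longrightarrow> 0 < e u"
    "\<And>u. u \<in> S \<Longrightarrow> pierceable m {F \<in> \<H> (e u). dist (dir F) u < e u}" by auto
  have "S \<subseteq> (\<Union>u\<in>S. ball u (e u))" using e(1) by force
  then obtain Q where Q: "Q \<subseteq> S" "finite Q" "S \<subseteq> (\<Union>u\<in>Q. ball u (e u))"
    using compactE_image[OF S, of S "\<lambda>u. ball u (e u)"] by auto
  \<comment> \<open>The extra 1 keeps the minimum defined and positive when \<open>Q\<close> is
    empty.\<close>
  define d where "d = Min (insert 1 (e ` Q))"
  have d: "0 < d" "\<And>u. u \<in> Q \<Longrightarrow> d \<le> e u"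
    unfolding d_def using Q(1,2) e(1) by auto
  have "pierceable m (\<Union>u\<in>Q. {F \<in> \<H> (e u). dist (dir F) u < e u})"
    using Q(1,2) e(2) by (intro pierceable_UN) auto
  moreover have "\<H> d \<subseteq> (\<Union>u\<in>Q. {F \<in> \<H> (e u). dist (dir F) u < e u})"
  proof
    fix F assume F: "F \<in> \<H> d"
    have "dir F \<in> (\<Union>u\<in>Q. ball u (e u))" using Q(3) dir[OF d(1) F] by (rule subsetD)
    then obtain u where "u \<in> Q" "dist u (dir F) < e u" by auto
    then show "F \<in> (\<Union>u\<in>Q. {F \<in> \<H> (e u). dist (dir F) u < e u})"
      using subsetD[OF mono[OF d(2)] F, of u] by (auto simp: dist_commute)
  qed
  ultimately show False using np[OF d(1)] pierceable_mono by blast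
qed

section \<open>Fat sets seen from a subspace\<close>

text \<open>One size function \<open>\<rho>\<close> replaces both radii: up to constant factors it
  is the diameter as well as the radius of an inner ball.\<close>

locale fat_family =
  fixes \<F> :: "'a::euclidean_space set set" and \<rho> :: "'a set \<Rightarrow> real" and \<sigma> :: real
  assumes \<sigma>_pos: "0 < \<sigma>"
    and compact: "F \<in> \<F> \<Longrightarrow> compact F"
    and convex: "F \<in> \<F> \<Longrightarrow> convex F"
    and \<rho>_pos: "F \<in> \<F> \<Longrightarrow> 0 < \<rho> F"
    and dist_le: "F \<in> \<F> \<Longrightarrow> x \<in> F \<Longrightarrow> y \<in> F \<Longrightarrow> dist x y \<le> \<rho> F"
    and cball_subset: "F \<in> \<F> \<Longrightarrow> \<exists>z. cball z (\<sigma> * \<rho> F) \<subseteq> F"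
begin

abbreviation far :: "('a \<times> real) set \<Rightarrow> 'a \<Rightarrow> real" where
  "far V x \<equiv> infdist (x, 1) V"

lemma obtain_inner_ball:
  assumes "F \<in> \<F>"
  obtains z where "\<And>s. norm s \<le> \<sigma> * \<rho> F \<Longrightarrow> z + s \<in> F" "z \<in> F"
proof -
  obtain z where z: "cball z (\<sigma> * \<rho> F) \<subseteq> F" using cball_subset[OF assms] by blast
  have "z + s \<in> F" if "norm s \<le> \<sigma> * \<rho> F" for s
    using that z by (force simp: dist_norm)
  moreover from this[of 0] have "z \<in> F" using \<sigma>_pos \<rho>_pos[OF assms] by simp
  ultimately show ?thesis using that by blast
qed

lemma obtain_nearest:
  fixes V :: "'b::euclidean_space set"
  assumes "subspace V"
  obtains v where "v \<in> V" "infdist x V = norm (x - v)"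
proof -
  have "closed V" "V \<noteq> {}" using assms closed_subspace subspace_0 by blast+
  then show ?thesis using infdist_attains_inf that by (metis dist_norm)
qed

text \<open>
  Rescaled by \<open>1 / \<rho> F\<close>, the inner balls of these sets have a fixed radius and lie, modulo
  \<open>V\<close>, in a fixed compact set. The point \<open>(p, 1)\<close> of \<open>V\<close> is used to correct the last
  coordinate.
\<close>
lemma pierceable_near:
  assumes V: "subspace V" "dim V < m" "(p, 1) \<in> V"
  shows "pierceable m {F \<in> \<F>. \<exists>x\<in>F. far V x \<le> C * \<rho> F}"
proof (rule pierceable_net[OF V(2)])
  \<comment> \<open>\<open>C\<close> bounds the rescaled distance of \<open>x\<close> to
    \<open>V\<close>, and 1 the rescaled step from \<open>x\<close> to the centre
    \<open>z\<close>.\<close>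
  show "compact (cball (0 :: 'a \<times> real) (C + 1))" by simp
  \<comment> \<open>Restoring height 1 by a multiple of \<open>(p, 1)\<close> enlarges an error by a
    factor of at most \<open>1 + norm p\<close>.\<close>
  show "0 < \<sigma> / (1 + norm p)" using \<sigma>_pos by (simp add: add_pos_nonneg)
  fix F assume "F \<in> {F \<in> \<F>. \<exists>x\<in>F. far V x \<le> C * \<rho> F}"
  then obtain x where F: "F \<in> \<F>" and x: "x \<in> F" "far V x \<le> C * \<rho> F" by blast
  define R where "R = \<rho> F"
  have R: "0 < R" using \<rho>_pos[OF F] by (simp add: R_def)
  obtain v where v: "v \<in> V" "far V x = norm ((x, 1) - v)" using obtain_nearest[OF V(1)] by metis
  obtain z where z: "\<And>s. norm s \<le> \<sigma> * R \<Longrightarrow> z + s \<in> F" "z \<in> F"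
    using obtain_inner_ball[OF F] by (metis R_def)
  define h where "h = ((z, 1) - v) /\<^sub>R R"
  have "(z, 1) - v = ((x, 1) - v) + (z - x, 0)" by (simp add: prod_eq_iff)
  then have "norm ((z, 1) - v) \<le> norm ((x, 1) - v) + norm (z - x, 0 :: real)"
    by (metis norm_triangle_ineq)
  also have "\<dots> \<le> C * R + R"
    using x(2) v(2) dist_le[OF F z(2) x(1)] by (simp add: R_def dist_norm)
  finally have "inverse R * norm ((z, 1) - v) \<le> inverse R * (C * R + R)"
    by (rule mult_left_mono) (use R in simp)
  also have "\<dots> = C + 1" using R by (simp add: algebra_simps)
  finally have "norm h \<le> C + 1" unfolding h_def norm_scaleR using R by (simp only: abs_inverse abs_of_pos)
  moreover have "\<exists>x\<in>F. (x, 1) \<in> span (insert q V)" if q: "norm (q - h) < \<sigma> / (1 + norm p)" for q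
  proof -
    \<comment> \<open>The vector \<open>v + R *\<^sub>R q\<close> equals \<open>(z, 1) + s\<close>,
      of height \<open>1 + snd s\<close>. Subtracting \<open>snd s\<close> times
      \<open>(p, 1)\<close> brings it back to height 1 and moves it within the inner ball.\<close>
    define s where "s = R *\<^sub>R (q - h)"
    have "norm (fst s - snd s *\<^sub>R p) \<le> norm (fst s) + \<bar>snd s\<bar> * norm p"
      using norm_triangle_ineq4[of "fst s" "snd s *\<^sub>R p"] by simp
    also have "\<dots> \<le> norm s + norm s * norm p"
      using norm_fst_le[of "fst s" "snd s"] norm_snd_le[of "snd s" "fst s"]
      by (intro add_mono mult_right_mono) auto
    also have "\<dots> = R * (norm (q - h) * (1 + norm p))"
      using R unfolding s_def norm_scaleR by (simp add: distrib_left)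
    also have "\<dots> \<le> R * \<sigma>"
      using q R by (intro mult_left_mono) (auto simp: pos_less_divide_eq add_pos_nonneg)
    finally have "z + (fst s - snd s *\<^sub>R p) \<in> F" by (intro z(1)) (simp add: mult.commute)
    moreover have "(z + (fst s - snd s *\<^sub>R p), 1) \<in> span (insert q V)"
    proof -
      have "(z + (fst s - snd s *\<^sub>R p), 1) = ((z, 1) + s) - snd s *\<^sub>R (p, 1)"
        by (simp add: prod_eq_iff)
      also have "(z, 1) + s = v + R *\<^sub>R q"
        using R by (simp add: s_def h_def algebra_simps)
      finally show ?thesis
        using v(1) V(3)
        by (metis insertI1 insertI2 span_add span_base span_diff span_mul)
    qed
    ultimately show ?thesis by blast
  qed
  ultimately show "\<exists>h\<in>cball 0 (C + 1). \<forall>q\<in>cball 0 (C + 1). norm (q - h) < \<sigma> / (1 + norm p) \<longrightarrow>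
      (\<exists>x\<in>F. (x, 1) \<in> span (insert q V))"
    by (intro bexI[of _ h]) auto
qed

text \<open>
  If \<open>V\<close> lies at infinity, the members that are large as seen from \<open>V\<close> have \<open>\<rho> F\<close> bounded
  below; by convexity the inner balls can be shrunk towards a point of bounded distance.
\<close>
lemma pierceable_near_horizontal:
  assumes V: "subspace V" "dim V < m" "V \<subseteq> {w. snd w = 0}" and C: "0 < C"
  shows "pierceable m {F \<in> \<F>. (\<exists>x\<in>F. far V x \<le> M) \<and> (\<exists>x\<in>F. far V x \<le> C * \<rho> F)}"
proof (rule pierceable_net[OF V(2)])
  \<comment> \<open>Modulo the horizontal space \<open>V\<close> the height stays 1. The radius adds
    the distance \<open>M\<close> of \<open>x\<close> to \<open>V\<close> and the displacement
    \<open>t * R = 1 / C\<close> towards \<open>z\<close>.\<close>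
  let ?K = "cball (0 :: 'a \<times> real) (M + 1 / C) \<inter> {w. snd w = 1}"
  have "closed {w :: 'a \<times> real. snd w = 1}"
    by (intro closed_Collect_eq continuous_intros)
  then show "compact ?K" by (simp add: compact_Int_closed)
  show "0 < \<sigma> / C" using \<sigma>_pos C by simp
  fix F assume "F \<in> {F \<in> \<F>. (\<exists>x\<in>F. far V x \<le> M) \<and> (\<exists>x\<in>F. far V x \<le> C * \<rho> F)}"
  then obtain x y where F: "F \<in> \<F>" and x: "x \<in> F" "far V x \<le> M" and y: "y \<in> F" "far V y \<le> C * \<rho> F"
    by blast
  define R where "R = \<rho> F"
  have R: "0 < R" using \<rho>_pos[OF F] by (simp add: R_def)
  \<comment> \<open>Lifted points have height 1 and \<open>V\<close> has height 0. This bounds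
    \<open>R\<close> below by \<open>1 / C\<close>.\<close>
  have "1 \<le> far V y"
  proof -
    obtain w where w: "w \<in> V" "far V y = norm ((y, 1) - w)" using obtain_nearest[OF V(1)] by metis
    have "norm (snd ((y, 1) - w)) \<le> norm ((y, 1) - w)" by (metis norm_snd_le prod.collapse)
    then show ?thesis using w V(3) by auto
  qed
  then have CR: "1 \<le> C * R" using y(2) by (simp add: R_def)
  \<comment> \<open>The homothety with centre \<open>x\<close> and ratio \<open>t \<le> 1\<close>
    maps \<open>F\<close> into itself by convexity, and the inner ball to one of the fixed radius
    \<open>\<sigma> / C\<close>.\<close>
  define t where "t = 1 / (C * R)"
  have t: "0 < t" "t \<le> 1" "t * R = 1 / C" using CR C R by (auto simp: t_def)
  obtain v where v: "v \<in> V" "far V x = norm ((x, 1) - v)" using obtain_nearest[OF V(1)] by metis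
  have v0: "snd v = 0" using v(1) V(3) by auto
  obtain z where z: "\<And>s. norm s \<le> \<sigma> * R \<Longrightarrow> z + s \<in> F" "z \<in> F"
    using obtain_inner_ball[OF F] by (metis R_def)
  define c where "c = x + t *\<^sub>R (z - x)"
  have c: "c + s \<in> F" if s: "norm s \<le> \<sigma> / C" for s
  proof -
    have "norm (s /\<^sub>R t) \<le> (\<sigma> / C) / t"
      using s t(1) by (simp add: divide_inverse mult.commute)
    also have "\<dots> = \<sigma> * R" using t(1) C R by (simp add: t_def)
    finally have "z + s /\<^sub>R t \<in> F" by (rule z(1))
    then have "(1 - t) *\<^sub>R x + t *\<^sub>R (z + s /\<^sub>R t) \<in> F"
      using convex[OF F] x(1) t unfolding convex_def by auto
    also have "(1 - t) *\<^sub>R x + t *\<^sub>R (z + s /\<^sub>R t) = c + s"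
      using t(1) by (simp add: c_def algebra_simps)
    finally show ?thesis .
  qed
  define h where "h = (c, 1) - v"
  have "h = ((x, 1) - v) + (t *\<^sub>R (z - x), 0)" by (simp add: h_def c_def prod_eq_iff)
  then have "norm h \<le> norm ((x, 1) - v) + norm (t *\<^sub>R (z - x), 0 :: real)"
    by (metis norm_triangle_ineq)
  also have "norm (t *\<^sub>R (z - x), 0 :: real) = t * norm (z - x)" using t(1) by simp
  also have "\<dots> \<le> t * R"
    using t(1) dist_le[OF F z(2) x(1)] by (simp add: R_def dist_norm)
  finally have "norm h \<le> M + 1 / C" using x(2) v(2) t(3) by simp
  then have "h \<in> ?K" using v0 by (simp add: h_def)
  moreover have "\<exists>x\<in>F. (x, 1) \<in> span (insert q V)" if q: "norm (q - h) < \<sigma> / C" "snd q = 1" for q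
  proof
    have "norm (fst (q - h)) \<le> norm (q - h)" by (metis norm_fst_le prod.collapse)
    then show "c + fst (q - h) \<in> F" using q(1) by (intro c) simp
    have "(c + fst (q - h), 1) = v + q" using q(2) v0 by (simp add: h_def prod_eq_iff)
    then show "(c + fst (q - h), 1) \<in> span (insert q V)"
      using v(1) by (auto intro!: span_add intro: span_base)
  qed
  ultimately show "\<exists>h\<in>?K. \<forall>q\<in>?K. norm (q - h) < \<sigma> / C \<longrightarrow> (\<exists>x\<in>F. (x, 1) \<in> span (insert q V))"
    by (intro bexI[of _ h]) auto
qed

text \<open>A member that is tiny compared with its distance to \<open>V\<close> is seen from
  \<open>V\<close> in essentially one direction. By compactness these directions accumulate at some
  \<open>u\<close> without making the family pierceable, and members seen near \<open>u\<close> are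
  relatively close to the span of \<open>u\<close> and \<open>V\<close>. The sets
  \<open>\<K> e\<close> carry along closeness conditions imposed earlier.\<close>

lemma obtain_direction:
  assumes V: "subspace V" and K: "\<And>d e. d \<le> e \<Longrightarrow> \<K> d \<subseteq> \<K> e"
    and np: "\<And>e. 0 < e \<Longrightarrow> \<not> pierceable m {F \<in> \<F> \<inter> \<K> e. \<forall>x\<in>F. \<rho> F < e * far V x}"
  obtains u where "u \<notin> V"
    "\<And>e. 0 < e \<Longrightarrow> \<not> pierceable m {F \<in> \<F> \<inter> \<K> e. \<forall>x\<in>F. far (span (insert u V)) x \<le> e * far V x}"
proof -
  \<comment> \<open>The unit vectors orthogonal to \<open>V\<close>, expressed by closed conditions;
    none of them lies in \<open>V\<close>.\<close>
  define S where "S = sphere 0 1 \<inter> (\<Inter>w\<in>V. {u :: 'a \<times> real. 1 \<le> norm (u - w)})"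
  have "closed {u :: 'a \<times> real. 1 \<le> norm (u - w)}" for w
    by (intro closed_Collect_le continuous_intros)
  then have S: "compact S" unfolding S_def by (intro compact_Int_closed closed_INT) auto
  define \<H> where "\<H> e = {F \<in> \<F> \<inter> \<K> e. \<forall>x\<in>F. \<rho> F < e * far V x}" for e
  have dir_ex: "\<exists>u. u \<in> S \<and> (\<exists>x\<in>F. \<exists>v\<in>V. (x, 1) = v + far V x *\<^sub>R u)"
    if "0 < e" "F \<in> \<H> e" for e F
  proof -
    have F: "F \<in> \<F>" "\<And>x. x \<in> F \<Longrightarrow> \<rho> F < e * far V x" using that(2) by (auto simp: \<H>_def)
    obtain x where x: "x \<in> F" using obtain_inner_ball[OF F(1)] by metis
    obtain v where v: "v \<in> V" "far V x = norm ((x, 1) - v)" using obtain_nearest[OF V] by metis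
    define d where "d = far V x"
    have "0 < e * d" using F(2)[OF x] \<rho>_pos[OF F(1)] by (simp add: d_def)
    then have d: "0 < d" using that(1) by (simp add: zero_less_mult_iff)
    define u where "u = ((x, 1) - v) /\<^sub>R d"
    have "norm u = 1" using d v(2) by (simp add: u_def d_def)
    moreover have "1 \<le> norm (u - w)" if w: "w \<in> V" for w
    proof -
      have "v + d *\<^sub>R w \<in> V" using V v(1) w by (blast intro: subspace_add subspace_scale)
      then have "d \<le> norm ((x, 1) - (v + d *\<^sub>R w))"
        unfolding d_def using infdist_le dist_norm by metis
      also have "(x, 1) - (v + d *\<^sub>R w) = d *\<^sub>R (u - w)"
        using d by (simp add: u_def algebra_simps)
      also have "norm \<dots> = d * norm (u - w)" using d by simp
      finally show ?thesis using d by simp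
    qed
    moreover have "(x, 1) = v + far V x *\<^sub>R u" using d by (simp add: u_def d_def)
    ultimately show ?thesis using x v(1) by (intro exI[of _ u]) (auto simp: S_def)
  qed
  define dir where "dir F = (SOME u. u \<in> S \<and> (\<exists>x\<in>F. \<exists>v\<in>V. (x, 1) = v + far V x *\<^sub>R u))" for F
  have dir: "dir F \<in> S" "\<exists>x\<in>F. \<exists>v\<in>V. (x, 1) = v + far V x *\<^sub>R dir F" if "0 < e" "F \<in> \<H> e" for e F
    using someI_ex[OF dir_ex[OF that]] unfolding dir_def by blast+
  have mono: "\<H> d \<subseteq> \<H> e" if "d \<le> e" for d e
  proof
    fix F assume F: "F \<in> \<H> d"
    have "d * far V x \<le> e * far V x" for x
      using that infdist_nonneg by (rule mult_right_mono)
    then show "F \<in> \<H> e" using F K[OF that] by (fastforce simp: \<H>_def intro: less_le_trans)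
  qed
  obtain u where u: "u \<in> S" "\<And>e. 0 < e \<Longrightarrow> \<not> pierceable m {F \<in> \<H> e. dist (dir F) u < e}"
  proof (rule nonpierceable_direction[of S \<H> dir m])
    show "dir F \<in> S" if "0 < e" "F \<in> \<H> e" for e F using that by (rule dir(1))
    show "\<not> pierceable m (\<H> e)" if "0 < e" for e using np[OF that] by (simp add: \<H>_def)
  qed (use S mono in blast)+
  show ?thesis
  proof
    show "u \<notin> V" using u(1) by (force simp: S_def)
    fix e :: real assume e: "0 < e"
    \<comment> \<open>The error is at most \<open>3 * d\<close> times \<open>far V x\<close>: one
      \<open>d\<close> for moving from \<open>y\<close> to \<open>x\<close>, and two for the
      deviation of the direction, since \<open>far V y \<le> 2 * far V x\<close> when
      \<open>d \<le> 1\<close>.\<close>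
    define d where "d = min 1 (e / 3)"
    have d: "0 < d" "d \<le> 1" "3 * d \<le> e" "d \<le> e" using e by (auto simp: d_def)
    have "far (span (insert u V)) x \<le> e * far V x"
      if F: "F \<in> \<H> d" "dist (dir F) u < d" and x: "x \<in> F" for F x
    proof -
      have FF: "F \<in> \<F>" and \<rho>: "\<rho> F < d * far V x" using F(1) x by (auto simp: \<H>_def)
      obtain y v where y: "y \<in> F" "v \<in> V" "(y, 1) = v + far V y *\<^sub>R dir F"
        using dir(2)[OF d(1) F(1)] by blast
      have yx: "dist y x \<le> d * far V x" using dist_le[OF FF y(1) x] \<rho> by linarith
      have "far V y \<le> far V x + dist (y, 1::real) (x, 1)" by (rule infdist_triangle)
      also have "dist (y, 1::real) (x, 1) = dist y x" by (simp add: dist_Pair_Pair)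
      also have "far V x + dist y x \<le> 2 * far V x"
        using yx d(2) mult_right_mono[OF d(2) infdist_nonneg[of "(x, 1)" V]] by linarith
      finally have fy: "far V y \<le> 2 * far V x" .
      have "v + far V y *\<^sub>R u \<in> span (insert u V)"
        using y(2) by (auto intro!: span_add span_mul intro: span_base)
      then have "far (span (insert u V)) x \<le> norm ((x, 1) - (v + far V y *\<^sub>R u))"
        using infdist_le dist_norm by metis
      also have "(x, 1) - (v + far V y *\<^sub>R u) = ((x, 1) - (y, 1)) + far V y *\<^sub>R (dir F - u)"
      proof -
        have "(x, 1) - (v + far V y *\<^sub>R u) =
            ((x, 1) - (v + far V y *\<^sub>R dir F)) + far V y *\<^sub>R (dir F - u)"
          by (simp add: algebra_simps)
        then show ?thesis using y(3) by simp
      qed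
      also have "norm \<dots> \<le> norm ((x, 1) - (y, 1 :: real)) + norm (far V y *\<^sub>R (dir F - u))"
        by (rule norm_triangle_ineq)
      also have "norm ((x, 1) - (y, 1 :: real)) = dist y x" by (simp add: dist_norm norm_minus_commute)
      also have "norm (far V y *\<^sub>R (dir F - u)) = far V y * dist (dir F) u"
        using infdist_nonneg[of "(y, 1)" V] by (simp add: dist_norm)
      also have "dist y x + far V y * dist (dir F) u \<le> d * far V x + (2 * far V x) * d"
        using yx fy F(2) infdist_nonneg[of "(x, 1)" V] by (intro add_mono mult_mono) auto
      also have "\<dots> = (3 * d) * far V x" by (simp add: algebra_simps)
      also have "\<dots> \<le> e * far V x" using d(3) infdist_nonneg by (rule mult_right_mono)
      finally show ?thesis .
    qed
    then have sub: "{F \<in> \<H> d. dist (dir F) u < d} \<subseteq> {F \<in> \<F> \<inter> \<K> e. \<forall>x\<in>F. far (span (insert u V)) x \<le> e * far V x}"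
      using K[OF d(4)] by (auto simp: \<H>_def)
    show "\<not> pierceable m {F \<in> \<F> \<inter> \<K> e. \<forall>x\<in>F. far (span (insert u V)) x \<le> e * far V x}"
      using u(2)[OF d(1)] pierceable_mono[OF _ sub] by blast
  qed
qed

section \<open>Flags approached by a non-pierceable family\<close>

definition flag_close :: "(nat \<Rightarrow> ('a \<times> real) set) \<Rightarrow> nat \<Rightarrow> real \<Rightarrow> 'a set set" where
  "flag_close V m e = {F. \<forall>i<m. \<forall>x\<in>F. far (V (Suc i)) x \<le> e * far (V i) x}"

lemma flag_close_mono: "d \<le> e \<Longrightarrow> flag_close V m d \<subseteq> flag_close V m e"
  unfolding flag_close_def by (blast intro: order_trans mult_right_mono infdist_nonneg)

lemma flag_close_Suc:
  "flag_close (V(Suc m := T)) (Suc m) e = {F \<in> flag_close V m e. \<forall>x\<in>F. far T x \<le> e * far (V m) x}"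
  by (auto simp: flag_close_def less_Suc_eq)

text \<open>Removing the pierceable set of members that look large from \<open>V m\<close> leaves a
  non-pierceable family of members that look small, to which the direction argument applies.\<close>

lemma extend_flag:
  assumes V: "subspace (V m)"
    and np: "\<And>e. 0 < e \<Longrightarrow> \<not> pierceable n (\<F> \<inter> flag_close V m e)"
    and near: "\<And>C. 0 < C \<Longrightarrow> \<exists>e>0. pierceable n {F \<in> \<F> \<inter> flag_close V m e. \<exists>x\<in>F. far (V m) x \<le> C * \<rho> F}"
  obtains u where "u \<notin> V m"
    "\<And>e. 0 < e \<Longrightarrow> \<not> pierceable n (\<F> \<inter> flag_close (V(Suc m := span (insert u (V m)))) (Suc m) e)"
proof -
  have "\<not> pierceable n {F \<in> \<F> \<inter> flag_close V m e. \<forall>x\<in>F. \<rho> F < e * far (V m) x}" (is "\<not> pierceable n ?A")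
    if e: "0 < e" for e
  proof
    assume A: "pierceable n ?A"
    \<comment> \<open>With the constant \<open>1 / e\<close>, \<open>?B\<close> catches every
      sufficiently close member outside \<open>?A\<close>.\<close>
    obtain e0 where e0: "0 < e0"
      "pierceable n {F \<in> \<F> \<inter> flag_close V m e0. \<exists>x\<in>F. far (V m) x \<le> (1 / e) * \<rho> F}" (is "pierceable n ?B")
      using near[of "1 / e"] e by auto
    have "\<F> \<inter> flag_close V m (min e e0) \<subseteq> ?A \<union> ?B"
    proof
      fix F assume F: "F \<in> \<F> \<inter> flag_close V m (min e e0)"
      then have "F \<in> flag_close V m e" "F \<in> flag_close V m e0"
        using flag_close_mono[of "min e e0"] by (meson IntD2 min.cobounded1 min.cobounded2 subsetD)+
      moreover have "far (V m) x \<le> (1 / e) * \<rho> F" if "\<not> \<rho> F < e * far (V m) x" for x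
        using that e by (simp add: field_simps)
      ultimately show "F \<in> ?A \<union> ?B" using F by blast
    qed
    moreover have "pierceable n (?A \<union> ?B)" using A e0(2) by (rule pierceable_Un)
    ultimately have "pierceable n (\<F> \<inter> flag_close V m (min e e0))" by (rule pierceable_mono[rotated])
    then show False using np[of "min e e0"] e e0(1) by simp
  qed
  note np' = this
  obtain u where u: "u \<notin> V m"
    "\<And>e. 0 < e \<Longrightarrow> \<not> pierceable n {F \<in> \<F> \<inter> flag_close V m e. \<forall>x\<in>F. far (span (insert u (V m))) x \<le> e * far (V m) x}"
    using obtain_direction[of "V m" "flag_close V m" n thesis, OF V flag_close_mono np' that] by blast
  show ?thesis
  proof
    show "u \<notin> V m" by (fact u(1))
    fix e :: real assume "0 < e"
    have "{F \<in> \<F> \<inter> flag_close V m e. \<forall>x\<in>F. far (span (insert u (V m))) x \<le> e * far (V m) x} =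
        \<F> \<inter> flag_close (V(Suc m := span (insert u (V m)))) (Suc m) e"
      unfolding flag_close_Suc by blast
    then show "\<not> pierceable n (\<F> \<inter> flag_close (V(Suc m := span (insert u (V m)))) (Suc m) e)"
      using u(2)[OF \<open>0 < e\<close>] by simp
  qed
qed

definition flag :: "(nat \<Rightarrow> ('a \<times> real) set) \<Rightarrow> nat \<Rightarrow> bool" where
  "flag V m \<longleftrightarrow> (\<forall>i\<le>m. subspace (V i) \<and> dim (V i) = i) \<and> (\<forall>i<m. V i \<subseteq> V (Suc i))"

lemma flag_extend:
  assumes "flag V m" "u \<notin> V m"
  shows "flag (V(Suc m := span (insert u (V m)))) (Suc m)"
proof -
  have "dim (span (insert u (V m))) = Suc m"
    using assms by (simp add: flag_def dim_insert span_eq_iff[THEN iffD2])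
  moreover have "V m \<subseteq> span (insert u (V m))" by (meson span_superset subset_insertI order_trans)
  ultimately show ?thesis using assms(1) by (auto simp: flag_def le_Suc_eq less_Suc_eq)
qed

text \<open>Before the last step a dimension is to spare: adjoining \<open>(0, 1)\<close> to
  \<open>V m\<close> gives a non-horizontal space of dimension still below \<open>k + 1\<close> and
  no farther from any point, so members large as seen from \<open>V m\<close> are
  pierceable.\<close>

lemma nonpierceable_flag:
  assumes np: "\<not> pierceable (Suc k) \<F>" and "m \<le> k"
  shows "\<exists>V. flag V m \<and> (\<forall>e>0. \<not> pierceable (Suc k) (\<F> \<inter> flag_close V m e))"
  using \<open>m \<le> k\<close>
proof (induction m)
  case 0
  have "flag (\<lambda>_. {0}) 0" by (simp add: flag_def)
  then show ?case using np by (auto simp: flag_close_def)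
next
  case (Suc m)
  then obtain V where V: "flag V m" and npV: "\<And>e. 0 < e \<Longrightarrow> \<not> pierceable (Suc k) (\<F> \<inter> flag_close V m e)"
    by auto
  have Vm: "subspace (V m)" "dim (V m) = m" using V by (auto simp: flag_def)
  define V' where "V' = span (insert (0, 1) (V m))"
  have "dim V' \<le> Suc m" by (simp add: V'_def dim_insert Vm)
  then have V': "subspace V'" "dim V' < Suc k" "(0, 1) \<in> V'" "V m \<subseteq> V'" "V m \<noteq> {}"
    using Suc.prems subspace_0[OF Vm(1)] by (auto simp: V'_def intro: span_base)
  have near: "pierceable (Suc k) {F \<in> \<F> \<inter> flag_close V m 1. \<exists>x\<in>F. far (V m) x \<le> C * \<rho> F}" for C
    by (rule pierceable_mono[OF pierceable_near[OF V'(1-3), of C]])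
      (use infdist_mono[OF V'(4,5)] order_trans in blast)
  obtain u where "u \<notin> V m"
    "\<And>e. 0 < e \<Longrightarrow> \<not> pierceable (Suc k) (\<F> \<inter> flag_close (V(Suc m := span (insert u (V m)))) (Suc m) e)"
  proof (rule extend_flag[of V m "Suc k", OF Vm(1) npV])
    show "\<exists>e>0. pierceable (Suc k) {F \<in> \<F> \<inter> flag_close V m e. \<exists>x\<in>F. far (V m) x \<le> C * \<rho> F}" for C
      using near zero_less_one by blast
  qed blast+
  then show ?case using flag_extend[OF V] by blast
qed

text \<open>
  The last member of the flag needs a case distinction: if \<open>V k\<close> lies at infinity and members
  of the family escape every bounded distance from it, the whole hyperplane at infinity is
  taken, since the members large as seen from \<open>V k\<close> need not be pierceable.
\<close>
lemma nonpierceable_complete_flag: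
  assumes np: "\<not> pierceable (Suc k) \<F>"
  shows "\<exists>V. flag V k \<and> subspace (V (Suc k)) \<and> V k \<subseteq> V (Suc k) \<and>
    (\<forall>e>0. \<exists>F\<in>\<F> \<inter> flag_close V (Suc k) e. \<forall>x\<in>F. (x, 1) \<notin> V (Suc k))"
proof -
  let ?H = "{w :: 'a \<times> real. snd w = 0}"
  obtain V where V: "flag V k" and npV: "\<And>e. 0 < e \<Longrightarrow> \<not> pierceable (Suc k) (\<F> \<inter> flag_close V k e)"
    using nonpierceable_flag[OF np order_refl] by blast
  have Vk: "subspace (V k)" "dim (V k) = k" "dim (V k) < Suc k" using V by (auto simp: flag_def)
  have flag_upd: "flag (V(Suc k := T)) k" for T
    using V by (auto simp: flag_def)
  have via_near: ?thesis
    if near: "\<And>C. 0 < C \<Longrightarrow> \<exists>e>0. pierceable (Suc k) {F \<in> \<F> \<inter> flag_close V k e. \<exists>x\<in>F. far (V k) x \<le> C * \<rho> F}"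
  proof -
    obtain u where u: "u \<notin> V k"
      "\<And>e. 0 < e \<Longrightarrow> \<not> pierceable (Suc k) (\<F> \<inter> flag_close (V(Suc k := span (insert u (V k)))) (Suc k) e)"
      by (rule extend_flag[of V k "Suc k", OF Vk(1) npV near]) blast+
    define T where "T = span (insert u (V k))"
    have T: "subspace T" "dim T \<le> Suc k" "V k \<subseteq> T"
      using Vk by (auto simp: T_def dim_insert intro: span_base)
    \<comment> \<open>\<open>T\<close> has dimension at most \<open>k + 1\<close>, so it alone
      pierces all members that meet it; a non-pierceable family has a member missing it.\<close>
    have "\<exists>F\<in>\<F> \<inter> flag_close (V(Suc k := T)) (Suc k) e. \<forall>x\<in>F. (x, 1) \<notin> T" if "0 < e" for e
    proof (rule ccontr)
      assume "\<not> ?thesis"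
      then have "\<F> \<inter> flag_close (V(Suc k := T)) (Suc k) e \<subseteq> {F. \<exists>x\<in>F. (x, 1) \<in> T}" by blast
      then show False
        using pierceable_mono[OF pierceable_subspace[OF T(1,2)]] u(2)[OF that] by (simp add: T_def)
    qed
    then show ?thesis using flag_upd[of T] T by (intro exI[of _ "V(Suc k := T)"]) auto
  qed
  show ?thesis
  proof (cases "V k \<subseteq> ?H")
    case False
    then obtain w where w: "w \<in> V k" "snd w \<noteq> 0" by blast
    \<comment> \<open>Scaling \<open>w\<close> to height 1 provides the point \<open>p\<close>
      required for correcting heights.\<close>
    have "(fst w /\<^sub>R snd w, 1) = w /\<^sub>R snd w" using w(2) by (simp add: prod_eq_iff)
    then have "(fst w /\<^sub>R snd w, 1) \<in> V k" using subspace_scale[OF Vk(1) w(1)] by simp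
    then have "pierceable (Suc k) {F \<in> \<F>. \<exists>x\<in>F. far (V k) x \<le> C * \<rho> F}" for C
      using pierceable_near[OF Vk(1,3)] by blast
    then have "pierceable (Suc k) {F \<in> \<F> \<inter> flag_close V k 1. \<exists>x\<in>F. far (V k) x \<le> C * \<rho> F}" for C
      by (rule pierceable_mono) blast
    then show ?thesis using via_near zero_less_one by blast
  next
    case True
    show ?thesis
    \<comment> \<open>Lifted points have distance at most 1 from the horizontal hyperplane, so the
      threshold \<open>1 / e\<close> is what makes this distance at most \<open>e\<close> times that
      to \<open>V k\<close>.\<close>
    proof (cases "\<forall>e>0. \<exists>F\<in>\<F> \<inter> flag_close V k e. \<forall>x\<in>F. 1 / e < far (V k) x")
      case escape: True
      have "\<exists>F\<in>\<F> \<inter> flag_close (V(Suc k := ?H)) (Suc k) e. \<forall>x\<in>F. (x, 1) \<notin> ?H" if e: "0 < e" for e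
      proof -
        obtain F where F: "F \<in> \<F> \<inter> flag_close V k e" "\<And>x. x \<in> F \<Longrightarrow> 1 / e < far (V k) x"
          using escape e by blast
        have "far ?H x \<le> e * far (V k) x" if "x \<in> F" for x
        proof -
          have "far ?H x \<le> dist (x, 1) (x, 0 :: real)" by (rule infdist_le) simp
          also have "\<dots> = 1" by (simp add: dist_Pair_Pair)
          also have "\<dots> \<le> e * far (V k) x" using F(2)[OF that] e by (simp add: field_simps)
          finally show ?thesis .
        qed
        then show ?thesis using F(1) by (intro bexI[of _ F]) (auto simp: flag_close_Suc)
      qed
      then show ?thesis using flag_upd[of ?H] True subspace_horizontal
        by (intro exI[of _ "V(Suc k := ?H)"]) auto
    next
      case False
      then obtain e where e: "0 < e" "\<And>F. F \<in> \<F> \<inter> flag_close V k e \<Longrightarrow> \<exists>x\<in>F. far (V k) x \<le> 1 / e"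
        by (meson not_less)
      have "pierceable (Suc k) {F \<in> \<F> \<inter> flag_close V k e. \<exists>x\<in>F. far (V k) x \<le> C * \<rho> F}" if "0 < C" for C
        by (rule pierceable_mono[OF pierceable_near_horizontal[OF Vk(1,3) True that, of "1 / e"]])
          (use e(2) in blast)
      then show ?thesis using via_near e(1) by blast
    qed
  qed
qed

text \<open>Members missing the top of the flag, with closeness \<open>1 / (N + 1)\<close>, are
  lifted to height 1 and thinned out. A \<open>k\<close>-flat meeting \<open>k + 2\<close> of the
  remaining ones would homogenize to a forbidden transversal.\<close>

lemma independent_sequence:
  assumes "\<not> pierceable (Suc k) \<F>"
  shows "\<exists>B. (\<forall>n. B n \<in> \<F>) \<and> k_independent k B"
proof -
  obtain V where V: "flag V k" "subspace (V (Suc k))" "V k \<subseteq> V (Suc k)"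
    and ex: "\<forall>e>0. \<exists>F\<in>\<F> \<inter> flag_close V (Suc k) e. \<forall>x\<in>F. (x, 1) \<notin> V (Suc k)"
    using nonpierceable_complete_flag[OF assms] by blast
  have "\<forall>N. \<exists>F. F \<in> \<F> \<inter> flag_close V (Suc k) (inverse (real (Suc N))) \<and> (\<forall>x\<in>F. (x, 1) \<notin> V (Suc k))"
  proof
    fix N
    have "0 < inverse (real (Suc N))" by simp
    with ex show "\<exists>F. F \<in> \<F> \<inter> flag_close V (Suc k) (inverse (real (Suc N))) \<and> (\<forall>x\<in>F. (x, 1) \<notin> V (Suc k))"
      by blast
  qed
  then obtain F where F: "\<And>N. F N \<in> \<F>" "\<And>N. F N \<in> flag_close V (Suc k) (inverse (real (Suc N)))"
    "\<And>N x. x \<in> F N \<Longrightarrow> (x, 1) \<notin> V (Suc k)"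
    by (metis IntE)
  define A where "A N = (\<lambda>x. (x, 1::real)) ` F N" for N
  obtain s where s: "strict_mono (s :: nat \<Rightarrow> nat)"
    "\<And>I W. card I = k + 2 \<Longrightarrow> subspace W \<Longrightarrow> dim W \<le> Suc k \<Longrightarrow> \<exists>i\<in>I. A (s i) \<inter> W = {}"
  proof (rule independent_subsequence_near_flag[of A V k])
    show "compact (A N)" for N
      unfolding A_def using compact[OF F(1)] by (intro compact_continuous_image continuous_intros)
    show "A N \<inter> V (Suc k) = {}" for N using F(3) by (auto simp: A_def)
    show "subspace (V i)" if "i \<le> Suc k" for i using V that by (auto simp: flag_def le_Suc_eq)
    show "V i \<subseteq> V (Suc i)" if "i \<le> k" for i using V that by (auto simp: flag_def le_less)
    show "dim (V i) = i" if "i \<le> k" for i using V(1) that by (auto simp: flag_def)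
    show "infdist y (V (Suc i)) \<le> infdist y (V i) * inverse (real (Suc N))" if "i \<le> k" "y \<in> A N" for N i y
      using F(2)[of N] that by (auto simp: A_def flag_close_def mult.commute less_Suc_eq_le)
  qed auto
  have "k_independent k (\<lambda>n. F (s n))"
    unfolding k_dependent_def
  proof
    assume "\<exists>K I. k_flat k K \<and> card I = k + 2 \<and> (\<forall>i\<in>I. K \<inter> F (s i) \<noteq> {})"
    then obtain K I where K: "k_flat k K" "card I = k + 2" "\<And>i. i \<in> I \<Longrightarrow> K \<inter> F (s i) \<noteq> {}" by blast
    obtain W :: "('a \<times> real) set" where W: "subspace W" "dim W \<le> Suc k" "\<And>x. x \<in> K \<Longrightarrow> (x, 1) \<in> W"
      using k_flat_homogenize[OF K(1)] by blast
    have "A (s i) \<inter> W \<noteq> {}" if "i \<in> I" for i using K(3)[OF that] W(3) by (auto simp: A_def)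
    then show False using s(2)[OF K(2) W(1,2)] by blast
  qed
  then show ?thesis using F(1) by (intro exI[of _ "\<lambda>n. F (s n)"]) simp
qed

end

theorem theorem17:
  fixes \<F> :: "(real ^ 'd) set set" and k :: nat and \<sigma> :: real
  assumes "k \<le> CARD('d) - 1"
    and "\<sigma> > 0"
    and "\<And>F. F \<in> \<F> \<Longrightarrow> compact F \<and> convex F \<and> condition_number F \<ge> \<sigma>"
  shows "finitely_pierceable k \<F> \<or> (\<exists>B. (\<forall>n. B n \<in> \<F>) \<and> k_independent k B)"
proof -
  \<comment> \<open>Twice the outer radius bounds the diameter; halving \<open>\<sigma>\<close>
    compensates, so that the inner ball keeps the radius
    \<open>\<sigma> * outer_radius F\<close>.\<close>
  interpret fat_family \<F> "\<lambda>F. 2 * outer_radius F" "\<sigma> / 2"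
  proof
    show "0 < \<sigma> / 2" using assms(2) by simp
    fix F assume F: "F \<in> \<F>"
    then show "compact F" "convex F" using assms(3) by auto
    note bounds = condition_number_bound[of F \<sigma>]
    show "0 < 2 * outer_radius F" using bounds(1) assms F by simp
    show "dist x y \<le> 2 * outer_radius F" if "x \<in> F" "y \<in> F" for x y
      using bounds(2) assms F that by blast
    show "\<exists>z. cball z (\<sigma> / 2 * (2 * outer_radius F)) \<subseteq> F" using bounds(3) assms F by simp
  qed
  have "k \<le> DIM(real ^ 'd)" using assms(1) by simp
  then show ?thesis
    using pierceable_imp_finitely_pierceable independent_sequence by blast
qed

end
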